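(* Let $N,q\ge1$ be integers, let $\lambda_1,\ldots,\lambda_N$ be linearly independent real numbers, and let $d(1),\ldots,d(N)$ be complex numbers. Let $\xi=\xi_\lambda(N,q)$ be the coefficient of linear spacing of order $q$ of $\lambda_1,\dots,\lambda_N$. Then for any bounded interval $J\subset\mathbb{R}$ of positive length $|J|$, $$\frac{1}{|J|}\int_J\Bigl|\sum_{n=1}^N d(n)e^{it\lambda_n}\Bigr|^{2q}dt\le\Bigl(\sum_{n=1}^N|d(n)|^2\Bigr)^q\Bigl(q!+\frac{2\min(N^q,\pi q!)}{|J|\,\xi}\Bigr).$$
   Context: Real numbers $\lambda_1,\ldots,\lambda_N$ are called linearly independent if no relation $a_1\lambda_1+\cdots+a_N\lambda_N=0$ with integer coefficients, not all zero, holds between them. Let $$E_q=\{\underline{k}=(k_1,\ldots,k_N): k_i \text{ nonnegative integers},\ k_1+\cdots+k_N=q\}.$$ The coefficient of linear spacing of order $q$ is $$\xi_\lambda(N,q)=\inf_{\underline{h},\underline{k}\in E_q,\ \underline{h}\ne\underline{k}}\bigl|(h_1-k_1)\lambda_1+\cdots+(h_N-k_N)\lambda_N\bigr|,$$ which is positive by linear independence (with the convention $\inf\emptyset=+\infty$ and $1/(+\infty)=0$, which is relevant only when $N=1$). *)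

theory Defs
  imports "HOL-Analysis.Analysis"
begin

definition lin_indep_over_int :: "nat \<Rightarrow> (nat \<Rightarrow> real) \<Rightarrow> bool" where
  "lin_indep_over_int N lam \<longleftrightarrow>
     (\<forall>a :: nat \<Rightarrow> int. (\<Sum>n=1..N. of_int (a n) * lam n) = 0 \<longrightarrow> (\<forall>n\<in>{1..N}. a n = 0))"

(* Tuples (k_1, ..., k_N) are functions on nat vanishing outside {1..N}, so that
   equality of functions is equality of tuples. *)
definition multi_indices :: "nat \<Rightarrow> nat \<Rightarrow> (nat \<Rightarrow> nat) set" where
  "multi_indices N q = {k. (\<forall>n. n \<notin> {1..N} \<longrightarrow> k n = 0) \<and> (\<Sum>n=1..N. k n) = q}"

(* The infimum is taken in the extended reals, where Inf {} = \<infinity> and c / \<infinity> = 0 for real c;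
   the index set is empty when N = 1. *)
definition linear_spacing :: "(nat \<Rightarrow> real) \<Rightarrow> nat \<Rightarrow> nat \<Rightarrow> ereal" where
  "linear_spacing lam N q =
     (INF (h, k) \<in> {(h, k). h \<in> multi_indices N q \<and> k \<in> multi_indices N q \<and> h \<noteq> k}.
        ereal \<bar>\<Sum>n=1..N. (real (h n) - real (k n)) * lam n\<bar>)"

end

theory Submission
  imports Defs
begin

text \<open>
  The \<open>q\<close>-th power of the exponential sum is again an exponential sum. By the multinomial theorem its
  frequencies are the numbers \<open>\<nu> k = k\<^sub>1\<lambda>\<^sub>1 + \<dots> + k\<^sub>N\<lambda>\<^sub>N\<close> with \<open>k\<close> in \<open>E\<^sub>q\<close>, and its coefficients are the
  multinomial terms \<open>c k\<close>. Linear independence makes the frequencies distinct, and by definition any two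
  of them are at least \<open>\<xi>\<close> apart. So the claim is a mean value estimate for the square of the modulus of
  a sum with \<open>\<xi>\<close>-separated frequencies.

  Such a square has an explicit primitive: a linear function of slope \<open>\<Sum>\<bar>c k\<bar>\<^sup>2\<close> plus the
  imaginary part of the Hilbert-type form \<open>\<Sum> w\<^sub>h cnj w\<^sub>k / (\<nu> h - \<nu> k)\<close> at a vector \<open>w\<close> with
  \<open>\<bar>w\<^sub>k\<bar> = \<bar>c k\<bar>\<close>. Integrating over an interval, one pays for the off-diagonal part at most twice a
  bound for this form, once at each endpoint (\<open>integral_cmod_square_trig_sum_le\<close>). The form is bounded
  in two ways, and these give the two entries of the minimum.

  \<^item> Termwise by \<open>(\<Sum>\<bar>c k\<bar>)\<^sup>2 / \<xi>\<close>. Here \<open>\<Sum>\<bar>c k\<bar> = (\<Sum>\<bar>d n\<bar>)\<^sup>q\<close>, and the Cauchy-Schwarz inequality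
    produces \<open>N\<^sup>q\<close>.
  \<^item> By the inequality of Montgomery and Vaughan with the bound \<open>\<pi> / \<xi> * \<Sum>\<bar>c k\<bar>\<^sup>2\<close>
    (\<open>hilbert_inequality_separated\<close>). Here \<open>\<Sum>\<bar>c k\<bar>\<^sup>2 \<le> q! (\<Sum>\<bar>d n\<bar>\<^sup>2)\<^sup>q\<close>, because a multinomial
    coefficient is at most \<open>q!\<close>; the same estimate handles the slope.

  For the Montgomery-Vaughan inequality, \<open>\<i>\<close> times the kernel \<open>A m n = 1 / (\<nu> m - \<nu> n)\<close> is Hermitian, so it
  is enough to bound its largest eigenvalue \<open>\<mu>\<close>. Partial fractions express \<open>A\<^sup>2\<close> by a commutator of \<open>A\<close>
  with a diagonal matrix and by the entries \<open>(A m n)\<^sup>2\<close>. The commutator vanishes on the eigenvector, and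
  what remains is at most three times the largest \<open>\<Sum>\<^sub>n (A m n)\<^sup>2\<close>. The separation of the frequencies
  and \<open>\<Sum> 1 / k\<^sup>2 = \<pi>\<^sup>2 / 6\<close> then give \<open>\<mu>\<^sup>2 \<le> (\<pi> / \<xi>)\<^sup>2\<close>.
\<close>

section \<open>The largest eigenvalue of a Hermitian form\<close>

text \<open>
  A zero of a nonnegative form minimises it, so the derivative there vanishes. The direction to look at
  is the residual \<open>r = C u\<close> itself: the form at \<open>u + t r\<close> equals \<open>2 t \<parallel>r\<parallel>\<^sup>2 + t\<^sup>2 G r r\<close>, and this is
  nonnegative for all real \<open>t\<close> only if \<open>r = 0\<close>.
\<close>

lemma hermitian_form_null_vector:
  fixes C :: "'a \<Rightarrow> 'a \<Rightarrow> complex" and u :: "'a \<Rightarrow> complex"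
  assumes herm: "\<And>m n. C n m = cnj (C m n)"
    and nonneg: "\<And>w. 0 \<le> Re (\<Sum>m\<in>I. \<Sum>n\<in>I. cnj (w m) * C m n * w n)"
    and null: "Re (\<Sum>m\<in>I. \<Sum>n\<in>I. cnj (u m) * C m n * u n) = 0"
    and "finite I" "m \<in> I"
  shows "(\<Sum>n\<in>I. C m n * u n) = 0"
proof -
  define r where "r = (\<lambda>m. \<Sum>n\<in>I. C m n * u n)"
  define G where "G = (\<lambda>v w. \<Sum>m\<in>I. \<Sum>n\<in>I. cnj (v m) * C m n * w n)"
  define R where "R = (\<Sum>m\<in>I. (cmod (r m))\<^sup>2)"
  have Gru: "G r u = of_real R"
  proof -
    have "G r u = (\<Sum>m\<in>I. cnj (r m) * r m)"
      unfolding G_def r_def by (simp add: sum_distrib_left mult.assoc)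
    also have "\<dots> = of_real R"
      unfolding R_def of_real_sum
      by (intro sum.cong refl) (metis complex_norm_square mult.commute)
    finally show ?thesis .
  qed
  have swap: "G v w = cnj (G w v)" for v w
    unfolding G_def cnj_sum
    by (subst sum.swap) (intro sum.cong refl, simp add: herm[symmetric] mult_ac)
  have expand: "Re (G (\<lambda>m. u m + of_real t * r m) (\<lambda>m. u m + of_real t * r m)) = 2 * t * R + t\<^sup>2 * Re (G r r)" for t
  proof -
    have "G (\<lambda>m. u m + of_real t * r m) (\<lambda>m. u m + of_real t * r m)
      = G u u + of_real t * G u r + of_real t * G r u + of_real t * of_real t * G r r"
      unfolding G_def by (simp add: algebra_simps sum.distrib sum_distrib_left)
    moreover have "G u r = of_real R" using Gru swap[of u r] by simp
    moreover have "Re (G u u) = 0" using null unfolding G_def .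
    ultimately show ?thesis using Gru
      by (simp add: power2_eq_square algebra_simps)
  qed
  have ge: "0 \<le> 2 * t * R + t\<^sup>2 * Re (G r r)" for t
    unfolding expand[symmetric] using nonneg unfolding G_def .
  have "R \<le> 0"
  \<comment> \<open>A suitable negative \<open>t\<close> makes the quadratic polynomial negative unless \<open>R \<le> 0\<close>.\<close>
  proof (cases "Re (G r r) = 0")
    case True
    then show ?thesis using ge[of "-1"] by simp
  next
    case False
    then have pos: "Re (G r r) > 0" using nonneg[of r] unfolding G_def by simp
    have "0 \<le> - (R\<^sup>2 / Re (G r r))"
      using ge[of "- R / Re (G r r)"] pos by (simp add: power2_eq_square)
    then have "R\<^sup>2 \<le> 0" using pos by (simp add: divide_le_0_iff zero_le_divide_iff)
    then show ?thesis by simp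
  qed
  then have "R = 0" unfolding R_def by (simp add: sum_nonneg antisym)
  then have "r m = 0" using assms(4,5) unfolding R_def by (simp add: sum_nonneg_eq_0_iff)
  then show ?thesis by (simp add: r_def)
qed

text \<open>
  The form attains its maximum \<open>\<mu>\<close> on the compact unit sphere. Then \<open>\<mu> \<parallel>w\<parallel>\<^sup>2 - H w\<close> is a nonnegative
  form that vanishes at the maximiser, which is therefore an eigenvector.
\<close>

lemma hermitian_form_extremal_eigenvector:
  fixes B :: "'a \<Rightarrow> 'a \<Rightarrow> complex"
  assumes herm: "\<And>m n. B n m = cnj (B m n)" and "finite I" "I \<noteq> {}"
  obtains u and \<mu> :: real where "(\<Sum>m\<in>I. (cmod (u m))\<^sup>2) = 1"
    and "\<forall>m\<in>I. (\<Sum>n\<in>I. B m n * u n) = of_real \<mu> * u m"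
    and "\<forall>w. Re (\<Sum>m\<in>I. \<Sum>n\<in>I. cnj (w m) * B m n * w n) \<le> \<mu> * (\<Sum>m\<in>I. (cmod (w m))\<^sup>2)"
proof -
  define H where "H = (\<lambda>w. Re (\<Sum>m\<in>I. \<Sum>n\<in>I. cnj (w m) * B m n * w n))"
  define L where "L = (\<lambda>w :: 'a \<Rightarrow> complex. \<Sum>m\<in>I. (cmod (w m))\<^sup>2)"
  \<comment> \<open>Vectors indexed by \<open>I\<close> are functions vanishing off \<open>I\<close>, so that the unit sphere
    is a closed subset of a product of compact sets.\<close>
  define K where "K = PiE UNIV (\<lambda>i. if i \<in> I then cball 0 1 else {0 :: complex})"
  define S where "S = K \<inter> {w. L w = 1}"
  have "compactin (product_topology (\<lambda>i. euclidean) UNIV) K"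
    unfolding K_def compactin_PiE by (auto simp: compactin_euclidean_iff)
  then have "compact K"
    by (simp add: euclidean_product_topology compactin_euclidean_iff)
  moreover have contc: "continuous_on A (\<lambda>w :: 'a \<Rightarrow> complex. w m)" for m A
    by (rule continuous_on_subset[OF continuous_on_product_coordinates subset_UNIV])
  have contL: "continuous_on UNIV L"
    unfolding L_def by (intro continuous_intros contc)
  have contH: "continuous_on A H" for A
    unfolding H_def by (intro continuous_intros contc)
  have "closed {w. L w = 1}"
    using contL by (intro closed_Collect_eq) auto
  ultimately have "compact S"
    unfolding S_def by (intro compact_Int_closed)
  have S_I: "w \<in> S" if "L w = 1" "\<And>i. i \<notin> I \<Longrightarrow> w i = 0" for w
  proof -
    have "cmod (w i) \<le> 1" if "i \<in> I" for i
    proof -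
      have "(cmod (w i))\<^sup>2 \<le> L w"
        unfolding L_def using that \<open>finite I\<close> by (intro member_le_sum) auto
      then show ?thesis using \<open>L w = 1\<close> by (simp add: abs_square_le_1)
    qed
    then show ?thesis using that unfolding S_def K_def by (auto simp: PiE_iff)
  qed
  obtain i where "i \<in> I" using \<open>I \<noteq> {}\<close> by blast
  have "(\<lambda>j. if j = i then 1 else 0) \<in> S"
    using \<open>i \<in> I\<close> \<open>finite I\<close> by (intro S_I) (auto simp: L_def if_distrib[of cmod] if_distrib[of "\<lambda>x. x\<^sup>2"] cong: if_cong)
  then have "S \<noteq> {}" by blast
  then obtain u where "u \<in> S" and umax: "\<And>w. w \<in> S \<Longrightarrow> H w \<le> H u"
    using continuous_attains_sup[OF \<open>compact S\<close> _ contH] by blast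
  define \<mu> where "\<mu> = H u"
  have "L u = 1" using \<open>u \<in> S\<close> by (simp add: S_def)
  have bound: "H w \<le> \<mu> * L w" for w
  proof (cases "L w = 0")
    case True
    then have "w m = 0" if "m \<in> I" for m
      using that \<open>finite I\<close> unfolding L_def by (simp add: sum_nonneg_eq_0_iff)
    then show ?thesis using True by (simp add: H_def)
  next
    case False
    moreover have "L w \<ge> 0" unfolding L_def by (simp add: sum_nonneg)
    ultimately have pos: "L w > 0" by simp
    define c where "c = 1 / sqrt (L w)"
    have c2: "c * c = 1 / L w" using pos by (simp add: c_def)
    define v where "v = (\<lambda>m. if m \<in> I then of_real c * w m else 0)"
    have "L v = c\<^sup>2 * L w"
      unfolding L_def v_def by (simp add: norm_mult power_mult_distrib sum_distrib_left)
    then have "L v = 1" using pos by (simp add: power2_eq_square c2)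
    then have "H v \<le> \<mu>" unfolding \<mu>_def by (intro umax S_I) (auto simp: v_def)
    moreover have "H v = (c * c) * H w"
    proof -
      have "(\<Sum>m\<in>I. \<Sum>n\<in>I. cnj (v m) * B m n * v n) = of_real (c * c) * (\<Sum>m\<in>I. \<Sum>n\<in>I. cnj (w m) * B m n * w n)"
        unfolding sum_distrib_left by (intro sum.cong refl) (simp add: v_def mult_ac)
      then show ?thesis unfolding H_def by simp
    qed
    ultimately show ?thesis using pos by (simp add: c2 field_simps)
  qed
  define C where "C = (\<lambda>m n. (if m = n then of_real \<mu> else 0) - B m n)"
  have Cform: "Re (\<Sum>m\<in>I. \<Sum>n\<in>I. cnj (w m) * C m n * w n) = \<mu> * L w - H w" for w
  proof -
    have "(\<Sum>m\<in>I. \<Sum>n\<in>I. cnj (w m) * C m n * w n)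
      = (\<Sum>m\<in>I. of_real \<mu> * (cnj (w m) * w m)) - (\<Sum>m\<in>I. \<Sum>n\<in>I. cnj (w m) * B m n * w n)"
    proof -
      have "cnj (w m) * C m n * w n
        = (if m = n then of_real \<mu> * (cnj (w m) * w n) else 0) - cnj (w m) * B m n * w n" for m n
        by (simp add: C_def algebra_simps)
      then show ?thesis using \<open>finite I\<close> by (simp add: sum_subtractf)
    qed
    also have "(\<Sum>m\<in>I. of_real \<mu> * (cnj (w m) * w m)) = of_real (\<mu> * L w)"
      unfolding L_def sum_distrib_left of_real_sum
      by (intro sum.cong refl) (metis complex_norm_square mult.commute of_real_mult)
    finally show ?thesis unfolding H_def by simp
  qed
  have eig: "(\<Sum>n\<in>I. B m n * u n) = of_real \<mu> * u m" if "m \<in> I" for m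
  proof -
    have "(\<Sum>n\<in>I. C m n * u n) = 0"
    proof (rule hermitian_form_null_vector)
      show "C n m = cnj (C m n)" for m n unfolding C_def using herm[of n m] by simp
      show "0 \<le> Re (\<Sum>m\<in>I. \<Sum>n\<in>I. cnj (w m) * C m n * w n)" for w
        unfolding Cform using bound[of w] by simp
      show "Re (\<Sum>m\<in>I. \<Sum>n\<in>I. cnj (u m) * C m n * u n) = 0"
        unfolding Cform using \<open>L u = 1\<close> by (simp add: \<mu>_def)
    qed (use that \<open>finite I\<close> in auto)
    then show ?thesis using that \<open>finite I\<close>
      by (simp add: C_def left_diff_distrib sum_subtractf if_distrib[of "\<lambda>x. x * _"] cong: if_cong)
  qed
  show thesis
    using that[of u \<mu>] \<open>L u = 1\<close> eig bound unfolding L_def H_def by blast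
qed

section \<open>Inverse square distances of separated points\<close>

text \<open>
  Rounding \<open>(\<nu> r - x) / \<delta>\<close> down is injective on \<open>\<delta>\<close>-separated points and only increases the summands.
  So the sum is dominated by \<open>1 / \<delta>\<^sup>2 * \<Sum> 1 / k\<^sup>2\<close> over \<open>k \<ge> 1\<close>.
\<close>

lemma sum_inverse_square_above_le:
  fixes \<nu> :: "'a \<Rightarrow> real"
  assumes fin: "finite X" and pos: "\<delta> > 0"
    and sep: "\<And>r s. r \<in> X \<Longrightarrow> s \<in> X \<Longrightarrow> r \<noteq> s \<Longrightarrow> \<delta> \<le> \<bar>\<nu> r - \<nu> s\<bar>"
    and above: "\<And>r. r \<in> X \<Longrightarrow> x + \<delta> \<le> \<nu> r"
  shows "(\<Sum>r\<in>X. 1 / (\<nu> r - x)\<^sup>2) \<le> pi\<^sup>2 / (6 * \<delta>\<^sup>2)"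
proof -
  \<comment> \<open>The shift by one matches the indexing from \<open>0\<close> in \<open>inverse_squares_sums\<close>.\<close>
  define f where "f = (\<lambda>r. nat \<lfloor>(\<nu> r - x) / \<delta>\<rfloor> - 1)"
  have ge1: "1 \<le> (\<nu> r - x) / \<delta>" if "r \<in> X" for r
    using above[OF that] pos by (simp add: field_simps)
  have f_le: "real (f r + 1) \<le> (\<nu> r - x) / \<delta>" if "r \<in> X" for r
  proof -
    have "1 \<le> \<lfloor>(\<nu> r - x) / \<delta>\<rfloor>" using ge1[OF that] by linarith
    then have "int (f r + 1) = \<lfloor>(\<nu> r - x) / \<delta>\<rfloor>" unfolding f_def by linarith
    then show ?thesis by linarith
  qed
  have f_gt: "(\<nu> r - x) / \<delta> < real (f r + 1) + 1" for r
    unfolding f_def by linarith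
  have inj: "inj_on f X"
  proof (rule inj_onI, rule ccontr)
    fix r s assume rs: "r \<in> X" "s \<in> X" "f r = f s" "r \<noteq> s"
    have "\<bar>(\<nu> r - x) / \<delta> - (\<nu> s - x) / \<delta>\<bar> < 1"
      using f_le[OF rs(1)] f_le[OF rs(2)] f_gt[of r] f_gt[of s] rs(3) by linarith
    moreover have "(\<nu> r - x) / \<delta> - (\<nu> s - x) / \<delta> = (\<nu> r - \<nu> s) / \<delta>"
      by (simp add: diff_divide_distrib)
    ultimately have "\<bar>\<nu> r - \<nu> s\<bar> < \<delta>" using pos by (simp add: field_simps)
    then show False using sep rs by force
  qed
  have "(\<Sum>r\<in>X. 1 / (\<nu> r - x)\<^sup>2) \<le> (\<Sum>r\<in>X. 1 / \<delta>\<^sup>2 * (1 / (real (f r) + 1)\<^sup>2))"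
  proof (rule sum_mono)
    fix r assume "r \<in> X"
    then have "\<delta> * (real (f r) + 1) \<le> \<nu> r - x"
      using f_le[of r] pos by (simp add: field_simps)
    moreover have p: "0 < \<delta> * (real (f r) + 1)" using pos by simp
    ultimately have "(\<delta> * (real (f r) + 1))\<^sup>2 \<le> (\<nu> r - x)\<^sup>2"
      by (intro power_mono) auto
    then have "1 / (\<nu> r - x)\<^sup>2 \<le> 1 / (\<delta> * (real (f r) + 1))\<^sup>2"
      using p by (intro divide_left_mono mult_pos_pos) (auto intro: less_le_trans)
    then show "1 / (\<nu> r - x)\<^sup>2 \<le> 1 / \<delta>\<^sup>2 * (1 / (real (f r) + 1)\<^sup>2)"
      by (simp add: power_mult_distrib)
  qed
  also have "\<dots> = 1 / \<delta>\<^sup>2 * (\<Sum>k\<in>f ` X. 1 / (real k + 1)\<^sup>2)"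
    by (simp add: sum_distrib_left sum.reindex[OF inj])
  also have "(\<Sum>k\<in>f ` X. 1 / (real k + 1)\<^sup>2) \<le> (\<Sum>k. 1 / (real k + 1)\<^sup>2)"
    using inverse_squares_sums fin by (intro sum_le_suminf) (auto simp: sums_iff add.commute)
  also have "(\<Sum>k. 1 / (real k + 1)\<^sup>2) = pi\<^sup>2 / 6"
    using inverse_squares_sums by (simp add: sums_iff add.commute)
  finally show ?thesis by (simp add: divide_right_mono mult.commute)
qed

text \<open>
  The points above and below \<open>\<nu> m\<close> contribute \<open>\<pi>\<^sup>2 / (6 \<delta>\<^sup>2)\<close> each; the lower ones reduce to the upper
  ones by reflection. The summand for \<open>n = m\<close> is zero since \<open>1 / 0 = 0\<close>.
\<close>

lemma sum_inverse_square_distance_le: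
  fixes \<nu> :: "'a \<Rightarrow> real"
  assumes fin: "finite I" and pos: "\<delta> > 0"
    and sep: "\<And>r s. r \<in> I \<Longrightarrow> s \<in> I \<Longrightarrow> r \<noteq> s \<Longrightarrow> \<delta> \<le> \<bar>\<nu> r - \<nu> s\<bar>"
    and "m \<in> I"
  shows "(\<Sum>n\<in>I. (1 / (\<nu> m - \<nu> n))\<^sup>2) \<le> pi\<^sup>2 / (3 * \<delta>\<^sup>2)"
proof -
  define X where "X = {n \<in> I. \<nu> m < \<nu> n}"
  define Y where "Y = {n \<in> I. \<nu> n < \<nu> m}"
  have "(\<Sum>n\<in>I. (1 / (\<nu> m - \<nu> n))\<^sup>2) = (\<Sum>n\<in>X \<union> Y. (1 / (\<nu> m - \<nu> n))\<^sup>2)"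
    using fin by (intro sum.mono_neutral_right) (auto simp: X_def Y_def)
  also have "\<dots> = (\<Sum>n\<in>X. (1 / (\<nu> m - \<nu> n))\<^sup>2) + (\<Sum>n\<in>Y. (1 / (\<nu> m - \<nu> n))\<^sup>2)"
    using fin by (intro sum.union_disjoint) (auto simp: X_def Y_def)
  also have "(\<Sum>n\<in>X. (1 / (\<nu> m - \<nu> n))\<^sup>2) = (\<Sum>n\<in>X. 1 / (\<nu> n - \<nu> m)\<^sup>2)"
    by (simp add: power_divide power2_commute)
  also have "\<dots> \<le> pi\<^sup>2 / (6 * \<delta>\<^sup>2)"
  proof (rule sum_inverse_square_above_le)
    show "\<nu> m + \<delta> \<le> \<nu> r" if "r \<in> X" for r
      using sep[of r m] that \<open>m \<in> I\<close> by (force simp: X_def)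
  qed (use fin pos sep in \<open>auto simp: X_def\<close>)
  also have "(\<Sum>n\<in>Y. (1 / (\<nu> m - \<nu> n))\<^sup>2) = (\<Sum>n\<in>Y. 1 / (- \<nu> n - - \<nu> m)\<^sup>2)"
    by (simp add: power_divide)
  also have "\<dots> \<le> pi\<^sup>2 / (6 * \<delta>\<^sup>2)"
  proof (rule sum_inverse_square_above_le)
    show "- \<nu> m + \<delta> \<le> - \<nu> r" if "r \<in> Y" for r
      using sep[of r m] that \<open>m \<in> I\<close> by (force simp: Y_def)
    show "\<delta> \<le> \<bar>- \<nu> r - - \<nu> s\<bar>" if "r \<in> Y" "s \<in> Y" "r \<noteq> s" for r s
      using sep[of r s] that by (auto simp: Y_def)
  qed (use fin pos in \<open>auto simp: Y_def\<close>)
  finally show ?thesis by simp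
qed

section \<open>The Hilbert inequality of Montgomery and Vaughan\<close>

text \<open>
  This computes the square of the matrix \<open>A\<close>, whose diagonal is zero by \<open>1 / 0 = 0\<close>. For distinct
  indices, partial fractions give \<open>A m n * A n l = A m l * (A m n - A l n)\<close>. The index values \<open>n = m\<close>
  and \<open>n = l\<close> break this identity, which produces \<open>2 * (A m l)\<^sup>2\<close>. With \<open>s\<close> the row sums of \<open>A\<close>,
  the first term is the entry of a commutator of \<open>A\<close> with the diagonal matrix \<open>s\<close>.
\<close>

lemma sum_inverse_distance_product:
  fixes \<nu> :: "'a \<Rightarrow> real"
  assumes "finite I" "inj_on \<nu> I" "m \<in> I" "l \<in> I"
  defines "A \<equiv> \<lambda>m n. 1 / (\<nu> m - \<nu> n)"
  shows "(\<Sum>n\<in>I. A m n * A n l) =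
    A m l * ((\<Sum>n\<in>I. A m n) - (\<Sum>n\<in>I. A l n)) - 2 * (A m l)\<^sup>2
      - (if m = l then \<Sum>n\<in>I. (A m n)\<^sup>2 else 0)"
proof -
  have eq: "\<nu> x = \<nu> y \<longleftrightarrow> x = y" if "x \<in> I" "y \<in> I" for x y
    using assms(2) that by (auto simp: inj_on_def)
  have "A m n * A n l = A m l * (A m n - A l n) - (if n = m then (A m l)\<^sup>2 else 0)
      - (if n = l then (A m l)\<^sup>2 else 0) - (if m = l then (A m n)\<^sup>2 else 0)" if "n \<in> I" for n
  proof (cases "m = l \<or> n = m \<or> n = l")
    case True
    have "A m m = 0" "A l l = 0" "A l m = - A m l" "A n m = - A m n"
      unfolding A_def minus_divide_right by simp_all
    then show ?thesis using True by (auto simp: power2_eq_square)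
  next
    case False
    then have "\<nu> m - \<nu> n \<noteq> 0" "\<nu> n - \<nu> l \<noteq> 0" "\<nu> m - \<nu> l \<noteq> 0" "\<nu> l - \<nu> n \<noteq> 0"
      using eq[of m n] eq[of n l] eq[of m l] that assms(3,4) by auto
    then show ?thesis using False by (simp add: A_def divide_simps) (simp add: algebra_simps)?
  qed
  then have "(\<Sum>n\<in>I. A m n * A n l) = (\<Sum>n\<in>I. A m l * (A m n - A l n) - (if n = m then (A m l)\<^sup>2 else 0)
      - (if n = l then (A m l)\<^sup>2 else 0) - (if m = l then (A m n)\<^sup>2 else 0))"
    by (intro sum.cong refl)
  also have "\<dots> = A m l * ((\<Sum>n\<in>I. A m n) - (\<Sum>n\<in>I. A l n)) - 2 * (A m l)\<^sup>2
      - (if m = l then \<Sum>n\<in>I. (A m n)\<^sup>2 else 0)"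
    using assms(1,3,4) by (simp add: sum_subtractf sum_distrib_left[symmetric])
  finally show ?thesis .
qed

text \<open>
  Since \<open>A\<close> is real and antisymmetric and \<open>A u = - \<i> \<mu> u\<close>, the number \<open>\<mu>\<^sup>2 = \<parallel>A u\<parallel>\<^sup>2\<close> is
  minus the form of \<open>A\<^sup>2\<close> at \<open>u\<close>. Its commutator part cancels because \<open>u\<close> is an eigenvector from both
  sides. The entries \<open>2 (A n l)\<^sup>2\<close> contribute at most twice, and the diagonal once, the mean
  of the row sums \<open>D n\<close> of squares with weights \<open>\<bar>u n\<bar>\<^sup>2\<close>.
\<close>

lemma eigenvalue_inverse_distance_kernel:
  fixes \<nu> :: "'a \<Rightarrow> real" and \<mu> :: real
  assumes fin: "finite I" and inj: "inj_on \<nu> I"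
    and eig: "\<And>m. m \<in> I \<Longrightarrow> (\<Sum>n\<in>I. of_real (1 / (\<nu> m - \<nu> n)) * u n) = - \<i> * of_real \<mu> * u m"
    and unit: "(\<Sum>m\<in>I. (cmod (u m))\<^sup>2) = 1"
    and bound: "\<And>m. m \<in> I \<Longrightarrow> (\<Sum>n\<in>I. (1 / (\<nu> m - \<nu> n))\<^sup>2) \<le> d"
  shows "\<mu>\<^sup>2 \<le> 3 * d"
proof -
  define A where "A = (\<lambda>m n. 1 / (\<nu> m - \<nu> n))"
  define s where "s = (\<lambda>m. \<Sum>n\<in>I. A m n)"
  define D where "D = (\<lambda>m. \<Sum>n\<in>I. (A m n)\<^sup>2)"
  have anti: "A n m = - A m n" for m n
    by (metis A_def minus_diff_eq minus_divide_right)
  have sym: "(A n m)\<^sup>2 = (A m n)\<^sup>2" for m n by (simp add: anti[of n m])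
  have eigA: "(\<Sum>n\<in>I. of_real (A m n) * u n) = - \<i> * of_real \<mu> * u m" if "m \<in> I" for m
    using eig[OF that] by (simp add: A_def)
  have eigA': "(\<Sum>n\<in>I. of_real (A m n) * cnj (u n)) = \<i> * of_real \<mu> * cnj (u m)" if "m \<in> I" for m
    using arg_cong[OF eigA[OF that], of cnj] by simp
  have nsq: "cnj z * z = of_real ((cmod z)\<^sup>2)" for z
    by (metis complex_norm_square mult.commute)
  have "complex_of_real (\<mu>\<^sup>2) = (\<Sum>m\<in>I. of_real (\<mu>\<^sup>2) * (cnj (u m) * u m))"
    unfolding nsq sum_distrib_left[symmetric] of_real_sum[symmetric] unit by simp
  also have "\<dots> = (\<Sum>m\<in>I. (\<Sum>n\<in>I. of_real (A m n) * cnj (u n)) * (\<Sum>l\<in>I. of_real (A m l) * u l))"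
    by (intro sum.cong refl) (simp only: eigA eigA', simp add: power2_eq_square algebra_simps)
  also have "\<dots> = (\<Sum>m\<in>I. \<Sum>n\<in>I. \<Sum>l\<in>I. cnj (u n) * u l * of_real (A m n * A m l))"
    unfolding sum_product by (intro sum.cong refl) (simp add: mult_ac)
  also have "\<dots> = (\<Sum>n\<in>I. \<Sum>m\<in>I. \<Sum>l\<in>I. cnj (u n) * u l * of_real (A m n * A m l))"
    by (rule sum.swap)
  also have "\<dots> = (\<Sum>n\<in>I. \<Sum>l\<in>I. \<Sum>m\<in>I. cnj (u n) * u l * of_real (A m n * A m l))"
    by (intro sum.cong refl sum.swap)
  also have "\<dots> = (\<Sum>n\<in>I. \<Sum>l\<in>I. cnj (u n) * u l * of_real (- (\<Sum>m\<in>I. A n m * A m l)))"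
  proof (intro sum.cong refl)
    fix n l
    have "(\<Sum>m\<in>I. A m n * A m l) = - (\<Sum>m\<in>I. A n m * A m l)"
      by (simp add: anti[of n] sum_negf)
    then show "(\<Sum>m\<in>I. cnj (u n) * u l * of_real (A m n * A m l))
      = cnj (u n) * u l * of_real (- (\<Sum>m\<in>I. A n m * A m l))"
      unfolding sum_distrib_left[symmetric] of_real_sum[symmetric] by simp
  qed
  also have "\<dots> = (\<Sum>n\<in>I. \<Sum>l\<in>I. of_real (s l) * u l * (of_real (A n l) * cnj (u n))
      - of_real (s n) * cnj (u n) * (of_real (A n l) * u l)
      + 2 * of_real ((A n l)\<^sup>2) * (cnj (u n) * u l)
      + (if n = l then of_real (D n) * (cnj (u n) * u n) else 0))"
  proof (intro sum.cong refl)
    fix n l assume "n \<in> I" "l \<in> I"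
    then have product: "(\<Sum>m\<in>I. A n m * A m l) = A n l * (s n - s l) - 2 * (A n l)\<^sup>2 - (if n = l then D n else 0)"
      using sum_inverse_distance_product[OF fin inj] unfolding A_def s_def D_def by blast
    show "cnj (u n) * u l * of_real (- (\<Sum>m\<in>I. A n m * A m l)) =
      of_real (s l) * u l * (of_real (A n l) * cnj (u n))
      - of_real (s n) * cnj (u n) * (of_real (A n l) * u l)
      + 2 * of_real ((A n l)\<^sup>2) * (cnj (u n) * u l)
      + (if n = l then of_real (D n) * (cnj (u n) * u n) else 0)"
      unfolding product by (cases "n = l") (simp_all add: algebra_simps)
  qed
  also have "\<dots> = (\<Sum>l\<in>I. of_real (s l) * u l * (\<Sum>n\<in>I. of_real (A n l) * cnj (u n)))
      - (\<Sum>n\<in>I. of_real (s n) * cnj (u n) * (\<Sum>l\<in>I. of_real (A n l) * u l))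
      + (\<Sum>n\<in>I. \<Sum>l\<in>I. 2 * of_real ((A n l)\<^sup>2) * (cnj (u n) * u l))
      + (\<Sum>n\<in>I. of_real (D n) * (cnj (u n) * u n))"
    unfolding sum_distrib_left
    using fin by (subst (1) sum.swap) (simp add: sum.distrib sum_subtractf)
  also have "(\<Sum>l\<in>I. of_real (s l) * u l * (\<Sum>n\<in>I. of_real (A n l) * cnj (u n)))
      = (\<Sum>n\<in>I. of_real (s n) * cnj (u n) * (\<Sum>l\<in>I. of_real (A n l) * u l))"
  proof (intro sum.cong refl)
    fix l assume l: "l \<in> I"
    have "(\<Sum>n\<in>I. of_real (A n l) * cnj (u n)) = - (\<Sum>n\<in>I. of_real (A l n) * cnj (u n))"
      by (simp add: anti[of l] sum_negf)
    then show "of_real (s l) * u l * (\<Sum>n\<in>I. of_real (A n l) * cnj (u n))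
      = of_real (s l) * cnj (u l) * (\<Sum>n\<in>I. of_real (A l n) * u n)"
      by (simp add: eigA[OF l] eigA'[OF l])
  qed
  \<comment> \<open>The two sums with the weights \<open>s\<close> were equal, so the commutator is gone.\<close>
  finally have key: "complex_of_real (\<mu>\<^sup>2) = (\<Sum>n\<in>I. \<Sum>l\<in>I. 2 * of_real ((A n l)\<^sup>2) * (cnj (u n) * u l))
      + (\<Sum>n\<in>I. of_real (D n) * (cnj (u n) * u n))" by simp
  have "\<mu>\<^sup>2 = (\<Sum>n\<in>I. \<Sum>l\<in>I. 2 * (A n l)\<^sup>2 * Re (cnj (u n) * u l)) + (\<Sum>n\<in>I. D n * (cmod (u n))\<^sup>2)"
  proof -
    have "Re (2 * of_real x * z) = 2 * x * Re z" for x z by simp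
    then show ?thesis using arg_cong[OF key, of Re] unfolding nsq
      by (simp only: Re_complex_of_real plus_complex.sel Re_sum of_real_mult[symmetric])
  qed
  also have "(\<Sum>n\<in>I. \<Sum>l\<in>I. 2 * (A n l)\<^sup>2 * Re (cnj (u n) * u l))
    \<le> (\<Sum>n\<in>I. \<Sum>l\<in>I. (A n l)\<^sup>2 * (cmod (u n))\<^sup>2 + (A n l)\<^sup>2 * (cmod (u l))\<^sup>2)"
  proof (intro sum_mono)
    fix n l
    have "2 * Re (cnj (u n) * u l) \<le> 2 * (cmod (u n) * cmod (u l))"
      using complex_Re_le_cmod[of "cnj (u n) * u l"] by (simp add: norm_mult)
    also have "\<dots> \<le> (cmod (u n))\<^sup>2 + (cmod (u l))\<^sup>2"
      using sum_squares_bound[of "cmod (u n)" "cmod (u l)"] by simp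
    finally have "(A n l)\<^sup>2 * (2 * Re (cnj (u n) * u l)) \<le> (A n l)\<^sup>2 * ((cmod (u n))\<^sup>2 + (cmod (u l))\<^sup>2)"
      by (rule mult_left_mono) simp
    then show "2 * (A n l)\<^sup>2 * Re (cnj (u n) * u l) \<le> (A n l)\<^sup>2 * (cmod (u n))\<^sup>2 + (A n l)\<^sup>2 * (cmod (u l))\<^sup>2"
      by (simp only: distrib_left mult_ac)
  qed
  also have "\<dots> = (\<Sum>n\<in>I. D n * (cmod (u n))\<^sup>2) + (\<Sum>l\<in>I. \<Sum>n\<in>I. (A l n)\<^sup>2 * (cmod (u l))\<^sup>2)"
    unfolding sum.distrib D_def sum_distrib_right
    by (subst (2) sum.swap) (simp add: sym)
  also have "(\<Sum>l\<in>I. \<Sum>n\<in>I. (A l n)\<^sup>2 * (cmod (u l))\<^sup>2) = (\<Sum>n\<in>I. D n * (cmod (u n))\<^sup>2)"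
    by (simp add: D_def sum_distrib_right)
  finally have "\<mu>\<^sup>2 \<le> 3 * (\<Sum>n\<in>I. D n * (cmod (u n))\<^sup>2)" by simp
  also have "(\<Sum>n\<in>I. D n * (cmod (u n))\<^sup>2) \<le> (\<Sum>n\<in>I. d * (cmod (u n))\<^sup>2)"
    using bound unfolding D_def A_def by (intro sum_mono mult_right_mono) auto
  also have "\<dots> = d" by (simp add: sum_distrib_left[symmetric] unit)
  finally show ?thesis by simp
qed

text \<open>
  The summands with \<open>m = n\<close> vanish by \<open>1 / 0 = 0\<close>. The form takes imaginary values, and conjugating the
  vector changes the sign. So a bound for the largest eigenvalue of the Hermitian kernel \<open>\<i> A\<close> bounds
  the modulus.
\<close>

theorem hilbert_inequality_separated:
  fixes \<nu> :: "'a \<Rightarrow> real"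
  assumes fin: "finite I" and pos: "\<delta> > 0"
    and sep: "\<And>r s. r \<in> I \<Longrightarrow> s \<in> I \<Longrightarrow> r \<noteq> s \<Longrightarrow> \<delta> \<le> \<bar>\<nu> r - \<nu> s\<bar>"
  shows "cmod (\<Sum>m\<in>I. \<Sum>n\<in>I. w m * cnj (w n) * of_real (1 / (\<nu> m - \<nu> n)))
    \<le> pi / \<delta> * (\<Sum>m\<in>I. (cmod (w m))\<^sup>2)"
proof (cases "I = {}")
  case False
  define A where "A = (\<lambda>m n. 1 / (\<nu> m - \<nu> n))"
  have anti: "A n m = - A m n" for m n
    by (metis A_def minus_diff_eq minus_divide_right)
  have inj: "inj_on \<nu> I" using sep pos by (force intro: inj_onI)
  have herm: "\<i> * complex_of_real (A n m) = cnj (\<i> * of_real (A m n))" for m n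
    by (simp add: anti[of m n])
  obtain u \<mu> where unit: "(\<Sum>m\<in>I. (cmod (u m))\<^sup>2) = 1"
    and eig: "\<forall>m\<in>I. (\<Sum>n\<in>I. \<i> * of_real (A m n) * u n) = of_real \<mu> * u m"
    and max: "\<forall>w. Re (\<Sum>m\<in>I. \<Sum>n\<in>I. cnj (w m) * (\<i> * of_real (A m n)) * w n)
      \<le> \<mu> * (\<Sum>m\<in>I. (cmod (w m))\<^sup>2)"
    by (rule hermitian_form_extremal_eigenvector[where B = "\<lambda>m n. \<i> * of_real (A m n)", OF herm fin False]) blast
  have "\<mu>\<^sup>2 \<le> 3 * (pi\<^sup>2 / (3 * \<delta>\<^sup>2))"
  proof (rule eigenvalue_inverse_distance_kernel[OF fin inj _ unit])
    show "(\<Sum>n\<in>I. of_real (1 / (\<nu> m - \<nu> n)) * u n) = - \<i> * of_real \<mu> * u m" if "m \<in> I" for m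
    proof -
      have "\<i> * (\<Sum>n\<in>I. of_real (A m n) * u n) = of_real \<mu> * u m"
        using eig that by (simp add: sum_distrib_left mult.assoc)
      then have "- \<i> * (\<i> * (\<Sum>n\<in>I. of_real (A m n) * u n)) = - \<i> * (of_real \<mu> * u m)" by simp
      then show ?thesis unfolding A_def by (simp add: mult.assoc[symmetric])
    qed
    show "(\<Sum>n\<in>I. (1 / (\<nu> m - \<nu> n))\<^sup>2) \<le> pi\<^sup>2 / (3 * \<delta>\<^sup>2)" if "m \<in> I" for m
      using sum_inverse_square_distance_le[OF fin pos sep that] .
  qed
  also have "3 * (pi\<^sup>2 / (3 * \<delta>\<^sup>2)) = (pi / \<delta>)\<^sup>2" by (simp add: power_divide)
  finally have mu: "\<mu> \<le> pi / \<delta>" using pos by (intro power2_le_imp_le[of \<mu>]) auto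
  define F where "F = (\<lambda>w. \<Sum>m\<in>I. \<Sum>n\<in>I. w m * cnj (w n) * of_real (A m n))"
  have le: "- Im (F w) \<le> pi / \<delta> * (\<Sum>m\<in>I. (cmod (w m))\<^sup>2)" for w
  proof -
    have "- Im (F w) = Re (\<i> * F w)" by simp
    also have "\<i> * F w = (\<Sum>m\<in>I. \<Sum>n\<in>I. cnj (cnj (w m)) * (\<i> * of_real (A m n)) * cnj (w n))"
      unfolding F_def sum_distrib_left by (simp add: mult_ac)
    also have "Re \<dots> \<le> \<mu> * (\<Sum>m\<in>I. (cmod (cnj (w m)))\<^sup>2)" using max by (rule spec)
    also have "\<dots> \<le> pi / \<delta> * (\<Sum>m\<in>I. (cmod (w m))\<^sup>2)"
      unfolding complex_mod_cnj using mu by (intro mult_right_mono sum_nonneg) auto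
    finally show ?thesis .
  qed
  have skew: "cnj (F w) = - F w"
    unfolding F_def cnj_sum sum_negf[symmetric]
  proof (subst sum.swap, intro sum.cong refl)
    fix m n
    show "cnj (w m * cnj (w n) * of_real (A m n)) = - (w n * cnj (w m) * of_real (A n m))"
      by (simp add: anti[of m n])
  qed
  have conj: "F (\<lambda>m. cnj (w m)) = - F w"
    unfolding skew[symmetric] unfolding F_def by simp
  have "cmod (F w) = \<bar>Im (F w)\<bar>"
    using arg_cong[OF skew, of Re] by (simp add: cmod_def)
  also have "\<dots> \<le> pi / \<delta> * (\<Sum>m\<in>I. (cmod (w m))\<^sup>2)"
    using le[of w] le[of "\<lambda>m. cnj (w m)"] unfolding conj by (simp add: abs_le_iff)
  finally show ?thesis unfolding F_def A_def .
qed simp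

lemma inverse_distance_form_trivial_bound:
  fixes \<nu> :: "'a \<Rightarrow> real"
  assumes pos: "\<delta> > 0"
    and sep: "\<And>r s. r \<in> I \<Longrightarrow> s \<in> I \<Longrightarrow> r \<noteq> s \<Longrightarrow> \<delta> \<le> \<bar>\<nu> r - \<nu> s\<bar>"
  shows "cmod (\<Sum>r\<in>I. \<Sum>s\<in>I. w r * cnj (w s) * of_real (1 / (\<nu> r - \<nu> s)))
    \<le> 1 / \<delta> * (\<Sum>r\<in>I. cmod (w r))\<^sup>2"
proof -
  have "cmod (\<Sum>r\<in>I. \<Sum>s\<in>I. w r * cnj (w s) * of_real (1 / (\<nu> r - \<nu> s)))
    \<le> (\<Sum>r\<in>I. \<Sum>s\<in>I. 1 / \<delta> * (cmod (w r) * cmod (w s)))"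
  proof (intro order_trans[OF norm_sum] sum_mono)
    fix r s assume rs: "r \<in> I" "s \<in> I"
    have "\<bar>1 / (\<nu> r - \<nu> s)\<bar> \<le> 1 / \<delta>"
    proof (cases "r = s")
      case False
      then show ?thesis using sep[OF rs False] pos by (simp add: frac_le)
    qed (use pos in simp)
    then have "\<bar>1 / (\<nu> r - \<nu> s)\<bar> * (cmod (w r) * cmod (w s)) \<le> 1 / \<delta> * (cmod (w r) * cmod (w s))"
      by (rule mult_right_mono) simp
    then show "cmod (w r * cnj (w s) * of_real (1 / (\<nu> r - \<nu> s))) \<le> 1 / \<delta> * (cmod (w r) * cmod (w s))"
      by (simp only: norm_mult complex_mod_cnj norm_of_real mult_ac)
  qed
  also have "\<dots> = 1 / \<delta> * (\<Sum>r\<in>I. cmod (w r))\<^sup>2"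
    unfolding power2_eq_square sum_product by (simp only: sum_distrib_left)
  finally show ?thesis .
qed

section \<open>The mean square of an exponential sum\<close>

text \<open>
  Expanding the square, the diagonal has the primitive \<open>t * \<Sum>\<bar>c r\<bar>\<^sup>2\<close>. The off-diagonal
  exponentials of frequency \<open>\<nu> r - \<nu> s\<close> have as primitive the form with kernel \<open>1 / (\<nu> r - \<nu> s)\<close>
  at the vector \<open>c r * exp (\<i> t \<nu> r)\<close>, up to the factor \<open>1 / \<i>\<close>; the factor is absorbed by taking the
  imaginary part. The vector has the moduli of \<open>c\<close> for every \<open>t\<close>, so \<open>M\<close> bounds the form at both ends.
\<close>

lemma integral_cmod_square_trig_sum_le:
  fixes \<nu> :: "'a \<Rightarrow> real" and c :: "'a \<Rightarrow> complex"
  assumes fin: "finite I" and inj: "inj_on \<nu> I" and "a \<le> b"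
    and bound: "\<And>w. (\<And>r. r \<in> I \<Longrightarrow> cmod (w r) = cmod (c r)) \<Longrightarrow>
      cmod (\<Sum>r\<in>I. \<Sum>s\<in>I. w r * cnj (w s) * of_real (1 / (\<nu> r - \<nu> s))) \<le> M"
  shows "(LINT t:{a..b}|lborel. (cmod (\<Sum>r\<in>I. c r * exp (\<i> * of_real t * of_real (\<nu> r))))\<^sup>2)
    \<le> (b - a) * (\<Sum>r\<in>I. (cmod (c r))\<^sup>2) + 2 * M"
proof -
  define e where "e = (\<lambda>r t. exp (\<i> * of_real t * of_real (\<nu> r)))"
  define f where "f = (\<lambda>t. (cmod (\<Sum>r\<in>I. c r * e r t))\<^sup>2)"
  define R where "R = (\<Sum>r\<in>I. (cmod (c r))\<^sup>2)"
  define G where "G = (\<lambda>t. \<Sum>r\<in>I. \<Sum>s\<in>I. (c r * e r t) * cnj (c s * e s t) * of_real (1 / (\<nu> r - \<nu> s)))"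
  define F where "F = (\<lambda>t. t * R + Im (G t))"
  have ecnj: "cnj (e s t) = exp (- (\<i> * of_real t * of_real (\<nu> s)))" for s t
    by (simp add: e_def exp_cnj)
  have cmod_e: "cmod (c r * e r t) = cmod (c r)" for r t
    by (simp add: e_def norm_mult norm_exp_eq_Re)
  have ee: "e r t * cnj (e r t) = 1" for r t
    unfolding ecnj by (simp add: e_def exp_minus)
  have G_bound: "\<bar>Im (G t)\<bar> \<le> M" for t
    using bound[of "\<lambda>r. c r * e r t"] abs_Im_le_cmod[of "G t"] cmod_e unfolding G_def by (meson order_trans)
  have square: "of_real (f t) = of_real R
      + (\<Sum>r\<in>I. \<Sum>s\<in>I. if \<nu> r = \<nu> s then 0 else (c r * e r t) * cnj (c s * e s t))" for t
  proof -
    have "of_real (f t) = (\<Sum>r\<in>I. \<Sum>s\<in>I. (c r * e r t) * cnj (c s * e s t))"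
      unfolding f_def complex_norm_square cnj_sum sum_product ..
    also have "\<dots> = (\<Sum>r\<in>I. \<Sum>s\<in>I. (if r = s then of_real ((cmod (c r))\<^sup>2) else 0)
        + (if \<nu> r = \<nu> s then 0 else (c r * e r t) * cnj (c s * e s t)))"
    proof (intro sum.cong refl)
      fix r s assume "r \<in> I" "s \<in> I"
      then have "\<nu> r = \<nu> s \<longleftrightarrow> r = s" using inj by (auto simp: inj_on_def)
      moreover have "(c r * e r t) * cnj (c r * e r t) = of_real ((cmod (c r))\<^sup>2)"
        unfolding complex_norm_square[symmetric] cmod_e ..
      ultimately show "(c r * e r t) * cnj (c s * e s t) = (if r = s then of_real ((cmod (c r))\<^sup>2) else 0)
        + (if \<nu> r = \<nu> s then 0 else (c r * e r t) * cnj (c s * e s t))" by auto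
    qed
    finally show ?thesis using fin by (simp add: sum.distrib R_def)
  qed
  have G_deriv: "(G has_vector_derivative
      (\<Sum>r\<in>I. \<Sum>s\<in>I. if \<nu> r = \<nu> s then 0 else \<i> * ((c r * e r t) * cnj (c s * e s t)))) (at t within X)" for t X
    unfolding G_def
  proof (intro has_vector_derivative_sum)
    fix r s
    have e_deriv: "(e r has_vector_derivative \<i> * of_real (\<nu> r) * e r t) (at t within X)" for r
      unfolding e_def
      by (rule has_vector_derivative_real_field) (auto intro!: derivative_eq_intros)
    show "((\<lambda>t. c r * e r t * cnj (c s * e s t) * complex_of_real (1 / (\<nu> r - \<nu> s))) has_vector_derivative
         (if \<nu> r = \<nu> s then 0 else \<i> * (c r * e r t * cnj (c s * e s t)))) (at t within X)"
    proof (cases "\<nu> r = \<nu> s")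
      case False
      define K where "K = complex_of_real (1 / (\<nu> r - \<nu> s))"
      have "((\<lambda>t. e r t * cnj (e s t)) has_vector_derivative
          e r t * cnj (\<i> * of_real (\<nu> s) * e s t) + \<i> * of_real (\<nu> r) * e r t * cnj (e s t)) (at t within X)"
        by (intro has_vector_derivative_mult e_deriv
            bounded_linear.has_vector_derivative[OF bounded_linear_cnj])
      then have "((\<lambda>t. c r * cnj (c s) * K * (e r t * cnj (e s t)))
          has_vector_derivative c r * cnj (c s) * K *
          (e r t * cnj (\<i> * of_real (\<nu> s) * e s t) + \<i> * of_real (\<nu> r) * e r t * cnj (e s t))) (at t within X)"
        by (rule bounded_linear.has_vector_derivative[OF bounded_linear_mult_right])
      moreover have "c r * cnj (c s) * K *
          (e r t * cnj (\<i> * of_real (\<nu> s) * e s t) + \<i> * of_real (\<nu> r) * e r t * cnj (e s t))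
        = K * of_real (\<nu> r - \<nu> s) * (\<i> * (c r * e r t * cnj (c s * e s t)))"
        by (simp add: algebra_simps)
      moreover have "K * of_real (\<nu> r - \<nu> s) = 1"
        using False unfolding K_def of_real_mult[symmetric] by simp
      moreover have "(\<lambda>t. c r * cnj (c s) * K * (e r t * cnj (e s t))) = (\<lambda>t. c r * e r t * cnj (c s * e s t) * K)"
        by (simp add: mult_ac)
      ultimately show ?thesis using False unfolding K_def[symmetric] by (simp only: mult_1_left if_False)
    qed simp
  qed
  have F_deriv: "(F has_vector_derivative f t) (at t within X)" for t X
  proof -
    have "f t = Re (of_real (f t))" by simp
    also have "\<dots> = R + Im (\<Sum>r\<in>I. \<Sum>s\<in>I. if \<nu> r = \<nu> s then 0 else \<i> * ((c r * e r t) * cnj (c s * e s t)))"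
    proof -
      have "(\<Sum>r\<in>I. \<Sum>s\<in>I. if \<nu> r = \<nu> s then 0 else \<i> * ((c r * e r t) * cnj (c s * e s t)))
        = \<i> * (\<Sum>r\<in>I. \<Sum>s\<in>I. if \<nu> r = \<nu> s then 0 else (c r * e r t) * cnj (c s * e s t))"
        unfolding sum_distrib_left by (intro sum.cong refl) simp
      then show ?thesis unfolding square by simp
    qed
    finally show ?thesis unfolding F_def
      using bounded_linear.has_vector_derivative[OF bounded_linear_Im G_deriv[of t X]]
      by (auto intro!: derivative_eq_intros)
  qed
  have "(LINT t:{a..b}|lborel. f t) = F b - F a"
    unfolding set_lebesgue_integral_def
  proof (rule integral_FTC_atLeastAtMost[OF \<open>a \<le> b\<close>])
    show "(F has_vector_derivative f t) (at t within {a..b})" for t by (rule F_deriv)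
    show "continuous_on {a..b} f"
      unfolding f_def e_def by (intro continuous_intros)
  qed
  also have "\<dots> \<le> (b - a) * R + 2 * M"
    using G_bound[of a] G_bound[of b] unfolding F_def by (simp add: algebra_simps abs_le_iff)
  finally show ?thesis unfolding f_def e_def R_def .
qed

section \<open>The multinomial theorem\<close>

text \<open>
  Requiring zero off \<open>A\<close> makes equality of functions the equality of multi-indices, and keeps the set
  finite.
\<close>

definition exponents :: "'a set \<Rightarrow> nat \<Rightarrow> ('a \<Rightarrow> nat) set" where
  "exponents A q = {k. (\<forall>n. n \<notin> A \<longrightarrow> k n = 0) \<and> sum k A = q}"

lemma finite_exponents:
  assumes "finite A"
  shows "finite (exponents A q)"
proof (rule finite_subset)
  show "exponents A q \<subseteq> {k. \<forall>n. (n \<in> A \<longrightarrow> k n \<in> {..q}) \<and> (n \<notin> A \<longrightarrow> k n = 0)}"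
    using member_le_sum[OF _ _ assms] by (fastforce simp: exponents_def)
qed (rule finite_set_of_finite_funs[OF assms], simp)

definition multinomial :: "'a set \<Rightarrow> ('a \<Rightarrow> nat) \<Rightarrow> 'b :: field_char_0" where
  "multinomial A k = fact (sum k A) / (\<Prod>n\<in>A. fact (k n))"

text \<open>
  Induction on the index set: the binomial theorem splits off the exponent \<open>j\<close> of the new variable, and
  pairs of \<open>j\<close> and a multi-index on \<open>A\<close> correspond to multi-indices on the larger set.
\<close>

theorem multinomial_theorem:
  fixes z :: "'a \<Rightarrow> 'b :: field_char_0"
  assumes "finite A"
  shows "(\<Sum>n\<in>A. z n) ^ q = (\<Sum>k\<in>exponents A q. multinomial A k * (\<Prod>n\<in>A. z n ^ k n))"
  using assms
proof (induction A arbitrary: q rule: finite_induct)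
  case empty
  have "exponents ({} :: 'a set) q = (if q = 0 then {\<lambda>_. 0} else {})"
    by (auto simp: exponents_def)
  then show ?case by (simp add: multinomial_def)
next
  case (insert a A)
  have "(\<Sum>n\<in>insert a A. z n) ^ q = (\<Sum>j\<le>q. of_nat (q choose j) * z a ^ j * (\<Sum>n\<in>A. z n) ^ (q - j))"
    using insert.hyps by (simp add: binomial_ring)
  also have "\<dots> = (\<Sum>j\<le>q. \<Sum>k\<in>exponents A (q - j).
      of_nat (q choose j) * z a ^ j * (multinomial A k * (\<Prod>n\<in>A. z n ^ k n)))"
    unfolding insert.IH sum_distrib_left ..
  also have "\<dots> = (\<Sum>(j, k)\<in>(SIGMA j:{..q}. exponents A (q - j)).
      of_nat (q choose j) * z a ^ j * (multinomial A k * (\<Prod>n\<in>A. z n ^ k n)))"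
    using finite_exponents[OF insert.hyps(1)] by (intro sum.Sigma) auto
  also have "\<dots> = (\<Sum>k\<in>exponents (insert a A) q.
      multinomial (insert a A) k * (\<Prod>n\<in>insert a A. z n ^ k n))"
  proof (rule sum.reindex_bij_witness[where j = "\<lambda>(j, k). k(a := j)" and i = "\<lambda>k. (k a, k(a := 0))"], goal_cases)
    case (1 p)
    then have "snd p a = 0" using insert.hyps by (auto simp: exponents_def)
    then show ?case by (auto simp: fun_upd_idem split: prod.splits)
  next
    case (2 p)
    have "sum (k(a := j)) A = sum k A" for k and j :: nat
      using insert.hyps by (intro sum.cong) auto
    then show ?case using 2 insert.hyps by (auto simp: exponents_def)
  next
    case (3 k)
    then show ?case by simp
  next
    case (4 k)
    have "sum (k(a := 0)) A = sum k A"
      using insert.hyps by (intro sum.cong) auto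
    then show ?case using 4 insert.hyps by (auto simp: exponents_def)
  next
    case (5 p)
    obtain j k where p: "p = (j, k)" by (cases p)
    have jk: "j \<le> q" "sum k A = q - j" using 5 by (auto simp: p exponents_def)
    have sum_upd: "(\<Sum>n\<in>A. if n = a then j else k n) = sum k A"
      using insert.hyps by (intro sum.cong) auto
    have fact_upd: "(\<Prod>n\<in>A. fact (if n = a then j else k n)) = (\<Prod>n\<in>A. fact (k n) :: 'b)"
      using insert.hyps by (intro prod.cong) auto
    have power_upd: "(\<Prod>n\<in>A. z n ^ (if n = a then j else k n)) = (\<Prod>n\<in>A. z n ^ k n)"
      using insert.hyps by (intro prod.cong) auto
    have "(of_nat (q choose j) :: 'b) = fact q / (fact j * fact (q - j))"
      by (rule binomial_fact[OF jk(1)])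
    then have "of_nat (q choose j) * multinomial A k = (multinomial (insert a A) (k(a := j)) :: 'b)"
      using insert.hyps jk by (simp add: multinomial_def fact_upd sum_upd)
    moreover have "z a ^ j * (\<Prod>n\<in>A. z n ^ k n) = (\<Prod>n\<in>insert a A. z n ^ (k(a := j)) n)"
      using insert.hyps by (simp add: power_upd)
    ultimately show ?case unfolding p prod.case by (metis mult.assoc mult.left_commute)
  qed
  finally show ?case .
qed

lemma multinomial_nonneg: "0 \<le> (multinomial A k :: real)"
  by (simp add: multinomial_def prod_nonneg)

lemma multinomial_le_fact: "(multinomial A k :: real) \<le> fact (sum k A)"
proof -
  have "1 \<le> (\<Prod>n\<in>A. fact (k n) :: real)" by (intro prod_ge_1) simp
  then show ?thesis unfolding multinomial_def by (simp add: divide_le_eq mult_le_cancel_left1)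
qed

lemma of_real_multinomial: "of_real (multinomial A k) = (multinomial A k :: complex)"
  by (simp add: multinomial_def)

lemma sum_cmod_multinomial_terms:
  fixes d :: "'a \<Rightarrow> complex"
  assumes "finite A"
  shows "(\<Sum>k\<in>exponents A q. cmod (multinomial A k * (\<Prod>n\<in>A. d n ^ k n))) = (\<Sum>n\<in>A. cmod (d n)) ^ q"
  unfolding multinomial_theorem[OF assms] of_real_multinomial[symmetric]
  by (simp add: norm_mult multinomial_nonneg prod_norm[symmetric] norm_power)

text \<open>
  One of the two factors \<open>multinomial A k\<close> in each square is replaced by its bound \<open>q!\<close>. The other
  one lets the multinomial theorem for the numbers \<open>\<bar>d n\<bar>\<^sup>2\<close> sum the terms.
\<close>

lemma sum_cmod_square_multinomial_terms_le:
  fixes d :: "'a \<Rightarrow> complex"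
  assumes "finite A"
  shows "(\<Sum>k\<in>exponents A q. (cmod (multinomial A k * (\<Prod>n\<in>A. d n ^ k n)))\<^sup>2)
    \<le> fact q * (\<Sum>n\<in>A. (cmod (d n))\<^sup>2) ^ q"
  unfolding multinomial_theorem[OF assms] sum_distrib_left
proof (rule sum_mono)
  fix k assume "k \<in> exponents A q"
  then have q: "sum k A = q" by (simp add: exponents_def)
  have "(cmod (multinomial A k * (\<Prod>n\<in>A. d n ^ k n)))\<^sup>2
    = multinomial A k * (multinomial A k * (\<Prod>n\<in>A. ((cmod (d n))\<^sup>2) ^ k n))"
    unfolding of_real_multinomial[symmetric]
    by (simp add: norm_mult multinomial_nonneg prod_norm[symmetric] norm_power power_mult_distrib
        prod_power_distrib power2_eq_square[of "multinomial A k"] power_mult[symmetric] mult.commute[of 2])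
  also have "\<dots> \<le> fact q * (multinomial A k * (\<Prod>n\<in>A. ((cmod (d n))\<^sup>2) ^ k n))"
    using multinomial_le_fact[of A k] q
    by (intro mult_right_mono mult_nonneg_nonneg multinomial_nonneg prod_nonneg) auto
  finally show "(cmod (multinomial A k * (\<Prod>n\<in>A. d n ^ k n)))\<^sup>2
    \<le> fact q * (multinomial A k * (\<Prod>n\<in>A. ((cmod (d n))\<^sup>2) ^ k n))" .
qed

section \<open>Mean values of powers of exponential sums\<close>

lemma trig_sum_power_eq:
  assumes "finite A"
  shows "(\<Sum>n\<in>A. d n * exp (\<i> * of_real t * of_real (lam n))) ^ q
    = (\<Sum>k\<in>exponents A q. (multinomial A k * (\<Prod>n\<in>A. d n ^ k n)) *
        exp (\<i> * of_real t * of_real (\<Sum>n\<in>A. real (k n) * lam n)))"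
  unfolding multinomial_theorem[OF assms]
proof (intro sum.cong refl)
  fix k
  have "(\<Prod>n\<in>A. exp (\<i> * of_real t * of_real (lam n)) ^ k n)
    = (\<Prod>n\<in>A. exp (\<i> * of_real t * of_real (real (k n) * lam n)))"
    by (intro prod.cong refl) (simp add: exp_of_nat_mult[symmetric] mult_ac)
  also have "\<dots> = exp (\<i> * of_real t * of_real (\<Sum>n\<in>A. real (k n) * lam n))"
    by (simp add: exp_sum[OF assms] sum_distrib_left)
  finally show "multinomial A k * (\<Prod>n\<in>A. (d n * exp (\<i> * of_real t * of_real (lam n))) ^ k n)
    = multinomial A k * (\<Prod>n\<in>A. d n ^ k n) * exp (\<i> * of_real t * of_real (\<Sum>n\<in>A. real (k n) * lam n))"
    by (simp add: power_mult_distrib prod.distrib mult.assoc)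
qed

text \<open>
  The estimate for a compact interval and an arbitrary lower bound \<open>\<delta>\<close> of the spacing. It serves both
  when the spacing is a positive real number and, by letting \<open>\<delta>\<close> grow, when there is only one
  multi-index.
\<close>

theorem integral_trig_sum_power_le:
  fixes d :: "'a \<Rightarrow> complex" and lam :: "'a \<Rightarrow> real"
  assumes fin: "finite A" and "a \<le> b" and pos: "\<delta> > 0"
    and sep: "\<And>h k. h \<in> exponents A q \<Longrightarrow> k \<in> exponents A q \<Longrightarrow> h \<noteq> k \<Longrightarrow>
      \<delta> \<le> \<bar>\<Sum>n\<in>A. (real (h n) - real (k n)) * lam n\<bar>"
  shows "(LINT t:{a..b}|lborel. cmod (\<Sum>n\<in>A. d n * exp (\<i> * of_real t * of_real (lam n))) ^ (2 * q))
    \<le> (\<Sum>n\<in>A. (cmod (d n))\<^sup>2) ^ q *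
      ((b - a) * fact q + 2 * min (real (card A) ^ q) (pi * fact q) / \<delta>)"
proof -
  define E where "E = exponents A q"
  define \<nu> where "\<nu> = (\<lambda>k. \<Sum>n\<in>A. real (k n) * lam n)"
  define c where "c = (\<lambda>k. multinomial A k * (\<Prod>n\<in>A. d n ^ k n))"
  define S where "S = (\<Sum>n\<in>A. (cmod (d n))\<^sup>2)"
  have "S \<ge> 0" by (simp add: S_def sum_nonneg)
  have finE: "finite E" unfolding E_def by (rule finite_exponents[OF fin])
  have sep\<nu>: "\<delta> \<le> \<bar>\<nu> h - \<nu> k\<bar>" if "h \<in> E" "k \<in> E" "h \<noteq> k" for h k
    using sep[of h k] that by (simp add: E_def \<nu>_def left_diff_distrib sum_subtractf)
  have inj: "inj_on \<nu> E" using sep\<nu> pos by (force intro: inj_onI)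
  have c2: "(\<Sum>k\<in>E. (cmod (c k))\<^sup>2) \<le> fact q * S ^ q"
    unfolding E_def c_def S_def by (rule sum_cmod_square_multinomial_terms_le[OF fin])
  have c1: "(\<Sum>k\<in>E. cmod (c k))\<^sup>2 \<le> real (card A) ^ q * S ^ q"
  proof -
    have "(\<Sum>k\<in>E. cmod (c k))\<^sup>2 = ((\<Sum>n\<in>A. cmod (d n))\<^sup>2) ^ q"
      unfolding E_def c_def sum_cmod_multinomial_terms[OF fin] by (simp add: power_mult[symmetric] mult.commute)
    also have "\<dots> \<le> (S * real (card A)) ^ q"
      unfolding S_def by (intro power_mono sum_squared_le_sum_of_squares) auto
    finally show ?thesis by (simp add: power_mult_distrib mult.commute)
  qed
  define M where "M = S ^ q * min (real (card A) ^ q) (pi * fact q) / \<delta>"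
  have "(LINT t:{a..b}|lborel. cmod (\<Sum>n\<in>A. d n * exp (\<i> * of_real t * of_real (lam n))) ^ (2 * q))
    = (LINT t:{a..b}|lborel. (cmod (\<Sum>k\<in>E. c k * exp (\<i> * of_real t * of_real (\<nu> k))))\<^sup>2)"
    unfolding E_def c_def \<nu>_def trig_sum_power_eq[OF fin, symmetric]
    by (simp add: norm_power power_mult[symmetric] mult.commute)
  also have "\<dots> \<le> (b - a) * (\<Sum>k\<in>E. (cmod (c k))\<^sup>2) + 2 * M"
  proof (rule integral_cmod_square_trig_sum_le[OF finE inj \<open>a \<le> b\<close>])
    fix w assume w: "\<And>k. k \<in> E \<Longrightarrow> cmod (w k) = cmod (c k)"
    define X where "X = cmod (\<Sum>h\<in>E. \<Sum>k\<in>E. w h * cnj (w k) * of_real (1 / (\<nu> h - \<nu> k)))"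
    have "X \<le> pi / \<delta> * (\<Sum>k\<in>E. (cmod (w k))\<^sup>2)"
      unfolding X_def by (rule hilbert_inequality_separated[OF finE pos sep\<nu>])
    also have "\<dots> \<le> pi / \<delta> * (fact q * S ^ q)"
      using c2 w pos by (intro mult_left_mono) auto
    finally have X1: "X \<le> S ^ q * (pi * fact q) / \<delta>" by (simp add: mult_ac)
    have "X \<le> 1 / \<delta> * (\<Sum>k\<in>E. cmod (w k))\<^sup>2"
      unfolding X_def by (rule inverse_distance_form_trivial_bound[OF pos sep\<nu>])
    also have "\<dots> \<le> 1 / \<delta> * (real (card A) ^ q * S ^ q)"
      using c1 w pos by (intro mult_left_mono) auto
    finally have X2: "X \<le> S ^ q * real (card A) ^ q / \<delta>" by (simp add: mult_ac)
    show "X \<le> M" using X1 X2 unfolding M_def min_def by (auto simp: mult_ac)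
  qed
  also have "\<dots> \<le> (b - a) * (fact q * S ^ q) + 2 * M"
    using c2 \<open>a \<le> b\<close> by (intro add_right_mono mult_left_mono) auto
  finally show ?thesis unfolding M_def S_def by (simp add: algebra_simps)
qed

section \<open>Bounded intervals and the coefficient of linear spacing\<close>

text \<open>
  A bounded interval differs from the compact interval between its infimum and supremum at most by the
  two endpoints.
\<close>

lemma bounded_interval_set_integral:
  fixes J :: "real set"
  assumes "is_interval J" "bounded J" "measure lborel J > 0"
  obtains a b where "a < b" "measure lborel J = b - a"
    "\<And>f :: real \<Rightarrow> real. f \<in> borel_measurable borel \<Longrightarrow> (LINT t:J|lborel. f t) = (LINT t:{a..b}|lborel. f t)"
proof -
  define a where "a = Inf J"
  define b where "b = Sup J"
  have ne: "J \<noteq> {}" using assms(3) by auto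
  have bdd: "bdd_above J" "bdd_below J"
    using assms(2) by (auto simp: bounded_imp_bdd_above bounded_imp_bdd_below)
  have outer: "J \<subseteq> {a..b}"
    using bdd by (auto simp: a_def b_def intro: cInf_lower cSup_upper)
  have inner: "{a<..<b} \<subseteq> J"
  proof
    fix x assume x: "x \<in> {a<..<b}"
    obtain y where "y \<in> J" "y < x" using x ne bdd by (auto simp: a_def cInf_less_iff)
    moreover obtain z where "z \<in> J" "x < z" using x ne bdd by (auto simp: b_def less_cSup_iff)
    ultimately show "x \<in> J" using assms(1) by (meson is_interval_1 less_imp_le)
  qed
  have "J = {a<..<b} \<union> (J \<inter> {a, b})" using outer inner by force
  moreover have "finite (J \<inter> {a, b})" by simp
  ultimately have [measurable]: "J \<in> sets borel"
    by (metis borel_open finite_imp_closed borel_closed open_greaterThanLessThan sets.Un)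
  have ae: "AE t in lborel. indicator J t = (indicator {a..b} t :: real)"
    using AE_lborel_singleton[of a] AE_lborel_singleton[of b]
    by eventually_elim (use outer inner in \<open>force simp: indicator_def\<close>)
  have "a \<le> b" using ne outer by force
  have eq: "(LINT t:J|lborel. f t) = (LINT t:{a..b}|lborel. f t)"
    if [measurable]: "f \<in> borel_measurable borel" for f :: "real \<Rightarrow> real"
    unfolding set_lebesgue_integral_def
    by (rule integral_cong_AE) (use ae in \<open>auto elim!: eventually_mono\<close>)
  have "measure lborel J = (LINT t:J|lborel. 1)"
    by (simp add: set_lebesgue_integral_def)
  also have "\<dots> = (LINT t:{a..b}|lborel. 1)" by (rule eq) simp
  also have "\<dots> = b - a" using \<open>a \<le> b\<close> by (simp add: set_lebesgue_integral_def)
  finally have m: "measure lborel J = b - a" .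
  then show thesis using that[of a b] assms(3) eq by simp
qed

lemma multi_indices_eq_exponents: "multi_indices N q = exponents {1..N} q"
  by (simp add: multi_indices_def exponents_def)

lemma linear_spacing_le:
  assumes "h \<in> multi_indices N q" "k \<in> multi_indices N q" "h \<noteq> k"
  shows "linear_spacing lam N q \<le> ereal \<bar>\<Sum>n=1..N. (real (h n) - real (k n)) * lam n\<bar>"
  unfolding linear_spacing_def using assms by (intro INF_lower2[of "(h, k)"]) auto

text \<open>
  The infimum is over a finite set of numbers, each positive because the difference of two distinct
  multi-indices is a nonzero integer vector, which linear independence does not let annihilate \<open>\<lambda>\<close>.
\<close>

lemma linear_spacing_pos:
  assumes "lin_indep_over_int N lam"
  shows "linear_spacing lam N q > 0"
proof -
  define P where "P = {(h, k). h \<in> multi_indices N q \<and> k \<in> multi_indices N q \<and> h \<noteq> k}"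
  define g where "g = (\<lambda>(h, k). \<bar>\<Sum>n=1..N. (real (h n) - real (k n)) * lam n\<bar>)"
  have fin: "finite P"
    by (rule finite_subset[of _ "multi_indices N q \<times> multi_indices N q"])
      (auto simp: P_def multi_indices_eq_exponents finite_exponents)
  have g_pos: "g (h, k) > 0" if "(h, k) \<in> P" for h k
  proof (rule ccontr)
    assume "\<not> g (h, k) > 0"
    then have "(\<Sum>n=1..N. of_int (int (h n) - int (k n)) * lam n) = 0"
      by (simp add: g_def)
    then have "\<forall>n\<in>{1..N}. int (h n) - int (k n) = 0"
      using assms[unfolded lin_indep_over_int_def, rule_format, of "\<lambda>n. int (h n) - int (k n)"] by blast
    moreover have "h n = k n" if "n \<notin> {1..N}" for n
      using \<open>(h, k) \<in> P\<close> that by (auto simp: P_def multi_indices_def)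
    ultimately have "h = k" by (intro ext) force
    then show False using that by (simp add: P_def)
  qed
  \<comment> \<open>The element \<open>1\<close> keeps the minimum meaningful when there are no pairs.\<close>
  define \<delta> where "\<delta> = Min (insert 1 (g ` P))"
  have "\<delta> > 0" unfolding \<delta>_def using fin g_pos by (subst Min_gr_iff) auto
  moreover have "ereal \<delta> \<le> linear_spacing lam N q"
    unfolding linear_spacing_def P_def[symmetric]
  proof (rule INF_greatest)
    fix p assume "p \<in> P"
    then have "\<delta> \<le> g p" unfolding \<delta>_def using fin by (intro Min_le) auto
    then show "ereal \<delta> \<le> (case p of (h, k) \<Rightarrow> ereal \<bar>\<Sum>n=1..N. (real (h n) - real (k n)) * lam n\<bar>)"
      by (cases p) (simp add: g_def)
  qed
  ultimately show ?thesis by (metis ereal_less(2) less_le_trans)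
qed

theorem proposition7:
  fixes N q :: nat and lam :: "nat \<Rightarrow> real" and d :: "nat \<Rightarrow> complex" and J :: "real set"
  assumes "N \<ge> 1" and "q \<ge> 1"
    and "lin_indep_over_int N lam"
    and "is_interval J" and "bounded J" and "measure lborel J > 0"
  shows "ereal (1 / measure lborel J *
            (LINT t:J|lborel. cmod (\<Sum>n=1..N. d n * exp (\<i> * of_real t * of_real (lam n))) ^ (2 * q)))
         \<le> ereal ((\<Sum>n=1..N. (cmod (d n))\<^sup>2) ^ q) *
            (ereal (fact q) +
             ereal (2 * min (real N ^ q) (pi * fact q)) /
               (ereal (measure lborel J) * linear_spacing lam N q))"
proof -
  define f where "f = (\<lambda>t. cmod (\<Sum>n=1..N. d n * exp (\<i> * of_real t * of_real (lam n))) ^ (2 * q))"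
  define S where "S = (\<Sum>n=1..N. (cmod (d n))\<^sup>2) ^ q"
  define C where "C = 2 * min (real N ^ q) (pi * fact q)"
  define \<xi> where "\<xi> = linear_spacing lam N q"
  define l where "l = measure lborel J"
  have "f \<in> borel_measurable borel"
    unfolding f_def by (intro borel_measurable_continuous_onI continuous_intros)
  then obtain a b where ab: "a < b" "l = b - a"
    and int: "(LINT t:J|lborel. f t) = (LINT t:{a..b}|lborel. f t)"
    using bounded_interval_set_integral[OF assms(4-6)] unfolding l_def by metis
  have "l > 0" "S \<ge> 0" "C \<ge> 0"
    using assms(6) by (auto simp: l_def S_def C_def sum_nonneg)
  have bound: "1 / l * (LINT t:J|lborel. f t) \<le> S * (fact q + C / (l * \<delta>))"
    if "\<delta> > 0" "ereal \<delta> \<le> \<xi>" for \<delta>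
  proof -
    have "(LINT t:{a..b}|lborel. f t) \<le> S * (l * fact q + C / \<delta>)"
    proof -
      have sep: "\<delta> \<le> \<bar>\<Sum>n=1..N. (real (h n) - real (k n)) * lam n\<bar>"
        if "h \<in> exponents {1..N} q" "k \<in> exponents {1..N} q" "h \<noteq> k" for h k
        using order_trans[OF \<open>ereal \<delta> \<le> \<xi>\<close>[unfolded \<xi>_def] linear_spacing_le] that
        by (simp add: multi_indices_eq_exponents)
      show ?thesis
        using integral_trig_sum_power_le[where A = "{1..N}" and lam = lam and d = d and q = q,
          OF finite_atLeastAtMost less_imp_le[OF ab(1)] \<open>\<delta> > 0\<close> sep]
        unfolding f_def S_def C_def ab(2) card_atLeastAtMost diff_Suc_1 .
    qed
    also have "\<dots> = l * (S * (fact q + C / (l * \<delta>)))"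
      using \<open>l > 0\<close> \<open>\<delta> > 0\<close> by (simp add: field_simps)
    finally show ?thesis unfolding int using \<open>l > 0\<close> by (simp add: field_simps)
  qed
  have "\<xi> > 0" unfolding \<xi>_def by (rule linear_spacing_pos[OF assms(3)])
  then consider x where "\<xi> = ereal x" "x > 0" | "\<xi> = \<infinity>" by (cases \<xi>) auto
  then have "ereal (1 / l * (LINT t:J|lborel. f t)) \<le> ereal S * (ereal (fact q) + ereal C / (ereal l * \<xi>))"
  proof cases
    case 1
    then show ?thesis using bound[of x] \<open>l > 0\<close> by simp
  next
    case 2
    \<comment> \<open>Every positive \<open>\<delta>\<close> is now admissible, so the term with \<open>1 / \<delta>\<close> can be made arbitrarily small.\<close>
    have "1 / l * (LINT t:J|lborel. f t) \<le> S * fact q"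
    proof (rule field_le_epsilon)
      fix \<epsilon> :: real assume "\<epsilon> > 0"
      define \<delta> where "\<delta> = (S * C + 1) / (l * \<epsilon>)"
      have p: "S * C + 1 > 0" using \<open>S \<ge> 0\<close> \<open>C \<ge> 0\<close> by (simp add: add_nonneg_pos)
      have "\<delta> > 0" unfolding \<delta>_def using p \<open>l > 0\<close> \<open>\<epsilon> > 0\<close> by simp
      then have "1 / l * (LINT t:J|lborel. f t) \<le> S * fact q + S * C / (l * \<delta>)"
        using bound[of \<delta>] 2 by (simp add: distrib_left)
      also have "S * C / (l * \<delta>) = \<epsilon> * (S * C / (S * C + 1))"
        unfolding \<delta>_def using \<open>l > 0\<close> by simp
      also have "\<dots> \<le> \<epsilon>"
        using p \<open>\<epsilon> > 0\<close> by (intro mult_left_le) (auto simp: divide_le_eq)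
      finally show "1 / l * (LINT t:J|lborel. f t) \<le> S * fact q + \<epsilon>" by simp
    qed
    then show ?thesis using 2 \<open>l > 0\<close> by simp
  qed
  then show ?thesis unfolding f_def S_def C_def \<xi>_def l_def .
qed
end
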